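(* For each $n\in\mathbb{N}$ and $L\in\mathbb{N}_+$ with $0\le n\le L$ (and $L+2\le N$), the process $\mathrm{B}(n,L)$ on $\mathbb{T}_N$ (with constraint $\mathbf{b}_{n,L}$ and generator $\mathcal{L}_N^{n,L}$) enjoys the following properties. (i) Partition of unity: for any integer $0<L<N/2$, $$\mathcal{L}_N^{\mathrm{SSEP}}=\sum_{n=0}^{L}\mathcal{L}_N^{n,L}.$$ (ii) Symmetry: for any $\eta\in\Omega_N$, $\mathbf{b}_{n,L}(\eta)=\mathbf{b}_{L-n,L}(\overline{\eta})$, where $\overline{\eta}(x)=1-\eta(x)$ for all $x$. (iii) Interpolation: for each $n\in\mathbb{N}_+$, $\mathrm{B}(n,n)=\mathrm{PMM}(n)$. (iv) Range: for each $\eta\in\Omega_N$, $\mathbf{b}_{n,L}(\eta)\in[0,1]$. (v) Blocked configurations: there is $\eta\in\Omega_N$ such that $\mathbf{b}_{n,L}(\tau^x\eta)=0$ for every $x\in\mathbb{T}_N$. (vi) Mobile clusters: any box of length $L+2$ with exactly $n+1$ particles constitutes a mobile cluster for $\mathrm{B}(n,L)$.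
   Context: $N\in\mathbb{N}_+$ is fixed, $\mathbb{T}_N=\mathbb{Z}/N\mathbb{Z}$ is the one-dimensional discrete torus and $\Omega_N=\{0,1\}^{\mathbb{T}_N}$; $\eta(x)\in\{0,1\}$ is the occupation value of $\eta$ at $x$ ($1$ = particle, $0$ = vacant site). The shift is $(\tau\eta)(x)=\eta(x+1)$, with iterates $\tau^x$. For sites $x,y$, $\theta_{x,y}\eta$ is $\eta$ with the occupation values at $x$ and $y$ exchanged, and $\nabla_{x,y}[f](\eta)=f(\theta_{x,y}\eta)-f(\eta)$ for $f:\Omega_N\to\mathbb{R}$. A constraint $\mathbf{c}:\Omega_N\to[0,\infty)$ defines the process with Markov generator $$\mathcal{L}_N[f](\eta)=\sum_{x\in\mathbb{T}_N}\mathbf{c}(\tau^x\eta)\,\nabla_{x,x+1}[f](\eta).$$ Two processes are identified when their constraints (hence their generators) coincide. SSEP: $\mathbf{c}\equiv1$, generator $\mathcal{L}_N^{\mathrm{SSEP}}$. $\mathrm{PMM}(n)$, $n\in\mathbb{N}_+$: $\mathbf{c}=\mathbf{c}^n$ with $$\mathbf{c}^n(\eta)=\frac{1}{n+1}\sum_{j=1}^{n+1}\ \prod_{\substack{i=-(n+1)+j\\ i\ne0,1}}^{j}\eta(i).$$ $\mathrm{B}(n,L)$ (Bernstein model), $0\le n\le L$, $L\ge1$: $\mathbf{c}=\mathbf{b}_{n,L}$, generator $\mathcal{L}_N^{n,L}$, where, with $W_j^L=\{-j,-j+1,\dots,-j+L+1\}\setminus\{0,1\}\subset\mathbb{T}_N$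 (a set of $L$ sites) and $m_j^L(\eta)=\sum_{x\in W_j^L}\eta(x)$, $$\mathbf{b}_{n,L}=\frac{1}{L+1}\sum_{j=0}^{L}\mathbf{b}_{n,L}^j,\qquad \mathbf{b}_{n,L}^j(\eta)=\mathbf{1}\{m_j^L(\eta)=n\}.$$ Mobile clusters. For a process with constraint $\mathbf{c}$, a jump in the node $\{x,x+1\}$ is the exchange $\eta\mapsto\theta_{x,x+1}\eta$ with $\eta(x)\ne\eta(x+1)$, and it is possible if $\mathbf{c}(\tau^x\eta)>0$. A box is a fixed finite pattern $\blacksquare\in\{0,1\}^k$ of particles and vacant sites placed on $k$ consecutive sites, with $k$ its length; let $\bullet$ denote a particle and $\circ$ a vacant site. The box $\blacksquare$ is a mobile cluster if (considering $N\ge k+2$, so that the patterns below fit in $\mathbb{T}_N$), wherever the patterns are placed: - Mobility: the transitions $\blacksquare\bullet\leftrightarrow\bullet\blacksquare$ and $\blacksquare\circ\leftrightarrow\circ\blacksquare$ are possible with a finite number of jumps, independently of the rest of the configuration; - Mass transport: the transitions $\blacksquare\circ\bullet\leftrightarrow\blacksquare\bullet\circ$ and $\circ\bullet\blacksquare\leftrightarrow\bullet\circ\blacksquare$ are possible with a finite number of jumps, independently of the rest of the configuration. Here a transition between two patterns on the same set of consecutive sites is possible independently of the rest of the configuration if there is a finite sequence of jumps, not depending on the occupation values outside these sites, each possible when performed in turn, which turns the first pattern into the second and leaves the configuration outside these sites unchanged. *)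

theory Defs
  imports Complex_Main "Berlekamp_Zassenhaus.Finite_Field"
begin

text \<open>
  The torus with N sites is the type \<^typ>\<open>'a mod_ring\<close> of integers modulo N, where N is
  \<open>CARD('a)\<close>.  The class \<open>nontriv\<close> says that N is at least 2, so that the ring has a unit; this
  costs nothing, because the models below are considered for N at least 3 only.
\<close>

type_synonym 'a config = "'a mod_ring \<Rightarrow> bool"

definition occ :: "'a::nontriv config \<Rightarrow> 'a mod_ring \<Rightarrow> nat"
  where "occ \<eta> x = of_bool (\<eta> x)"

text \<open>\<open>translate x\<close> is the iterate of order \<open>x\<close> of the shift \<open>translate 1\<close>, see
  \<open>translate_funpow\<close>.\<close>

definition translate :: "'a::nontriv mod_ring \<Rightarrow> 'a config \<Rightarrow> 'a config"
  where "translate x \<eta> = (\<lambda>y. \<eta> (y + x))"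

lemma translate_funpow: "(translate 1 ^^ k) \<eta> = translate (of_nat k) \<eta>"
  by (induction k) (simp_all add: translate_def add_ac)

definition exchange :: "'a::nontriv mod_ring \<Rightarrow> 'a mod_ring \<Rightarrow> 'a config \<Rightarrow> 'a config"
  where "exchange x y \<eta> = \<eta>(x := \<eta> y, y := \<eta> x)"

definition grad ::
  "'a::nontriv mod_ring \<Rightarrow> 'a mod_ring \<Rightarrow> ('a config \<Rightarrow> real) \<Rightarrow> 'a config \<Rightarrow> real"
  where "grad x y f \<eta> = f (exchange x y \<eta>) - f \<eta>"

definition complement :: "'a::nontriv config \<Rightarrow> 'a config"
  where "complement \<eta> = (\<lambda>x. \<not> \<eta> x)"

text \<open>
  A process is represented by its constraint: two processes are the same if and only if their
  constraints are equal.
\<close>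

definition generator ::
  "('a::nontriv config \<Rightarrow> real) \<Rightarrow> ('a config \<Rightarrow> real) \<Rightarrow> 'a config \<Rightarrow> real"
  where "generator c f \<eta> = (\<Sum>x\<in>UNIV. c (translate x \<eta>) * grad x (x + 1) f \<eta>)"

definition ssep :: "'a::nontriv config \<Rightarrow> real"
  where "ssep \<eta> = 1"

definition pmm :: "nat \<Rightarrow> 'a::nontriv config \<Rightarrow> real"
  where "pmm n \<eta> =
    1 / real (n + 1) *
      (\<Sum>j = 1..n + 1. \<Prod>i \<in> {- (int n + 1) + int j .. int j} - {0, 1}. real (occ \<eta> (of_int i)))"

definition window :: "nat \<Rightarrow> nat \<Rightarrow> 'a::nontriv mod_ring set"
  where "window L j = of_int ` {- int j .. - int j + int L + 1} - {0, 1}"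

definition window_mass :: "nat \<Rightarrow> nat \<Rightarrow> 'a::nontriv config \<Rightarrow> nat"
  where "window_mass L j \<eta> = (\<Sum>x\<in>window L j. occ \<eta> x)"

definition bernstein :: "nat \<Rightarrow> nat \<Rightarrow> 'a::nontriv config \<Rightarrow> real"
  where "bernstein n L \<eta> = 1 / real (L + 1) * (\<Sum>j = 0..L. of_bool (window_mass L j \<eta> = n))"

text \<open>
  \<open>jump_seq c xs \<eta> \<xi>\<close>: the jumps in the successive nodes \<open>{x, x + 1}\<close>, \<open>x\<close> running through \<open>xs\<close>,
  are each possible when performed in turn starting from \<open>\<eta>\<close>, and lead to \<open>\<xi>\<close>.
\<close>

definition possible_jump :: "('a::nontriv config \<Rightarrow> real) \<Rightarrow> 'a mod_ring \<Rightarrow> 'a config \<Rightarrow> bool"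
  where "possible_jump c x \<eta> \<longleftrightarrow> \<eta> x \<noteq> \<eta> (x + 1) \<and> c (translate x \<eta>) > 0"

primrec jump_seq ::
  "('a::nontriv config \<Rightarrow> real) \<Rightarrow> 'a mod_ring list \<Rightarrow> 'a config \<Rightarrow> 'a config \<Rightarrow> bool"
  where
    "jump_seq c [] \<eta> \<xi> \<longleftrightarrow> \<xi> = \<eta>"
  | "jump_seq c (x # xs) \<eta> \<xi> \<longleftrightarrow> possible_jump c x \<eta> \<and> jump_seq c xs (exchange x (x + 1) \<eta>) \<xi>"

text \<open>Patterns are lists, with \<^const>\<open>True\<close> for a particle and \<^const>\<open>False\<close> for a vacant site.\<close>

definition pattern_sites :: "'a::nontriv mod_ring \<Rightarrow> bool list \<Rightarrow> 'a mod_ring set"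
  where "pattern_sites z P = (\<lambda>i. z + of_nat i) ` {..<length P}"

definition occurs_at :: "'a::nontriv mod_ring \<Rightarrow> bool list \<Rightarrow> 'a config \<Rightarrow> bool"
  where "occurs_at z P \<eta> \<longleftrightarrow> (\<forall>i<length P. \<eta> (z + of_nat i) = P ! i)"

text \<open>
  The sequence \<open>xs\<close> of jumps is chosen before the configuration \<open>\<eta>\<close>: it may depend on the two
  patterns and on their position \<open>z\<close>, but not on the occupation values outside the pattern.
\<close>

definition transition :: "('a::nontriv config \<Rightarrow> real) \<Rightarrow> bool list \<Rightarrow> bool list \<Rightarrow> bool"
  where "transition c P Q \<longleftrightarrow> length P = length Q \<and>
    (\<forall>z. \<exists>xs. \<forall>\<eta>. occurs_at z P \<eta> \<longrightarrow>
      (\<exists>\<xi>. jump_seq c xs \<eta> \<xi> \<and> occurs_at z Q \<xi> \<and> (\<forall>y. y \<notin> pattern_sites z P \<longrightarrow> \<xi> y = \<eta> y)))"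

definition reversible_transition ::
  "('a::nontriv config \<Rightarrow> real) \<Rightarrow> bool list \<Rightarrow> bool list \<Rightarrow> bool"
  where "reversible_transition c P Q \<longleftrightarrow> transition c P Q \<and> transition c Q P"

definition mobility :: "('a::nontriv config \<Rightarrow> real) \<Rightarrow> bool list \<Rightarrow> bool"
  where "mobility c B \<longleftrightarrow>
    reversible_transition c (B @ [True]) ([True] @ B) \<and>
    reversible_transition c (B @ [False]) ([False] @ B)"

definition mass_transport :: "('a::nontriv config \<Rightarrow> real) \<Rightarrow> bool list \<Rightarrow> bool"
  where "mass_transport c B \<longleftrightarrow>
    reversible_transition c (B @ [False, True]) (B @ [True, False]) \<and>
    reversible_transition c ([False, True] @ B) ([True, False] @ B)"

text \<open>The torus is required to be large enough for all these patterns to fit in it; otherwise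
  \<^const>\<open>occurs_at\<close> would identify different sites of a pattern.\<close>

definition mobile_cluster :: "('a::nontriv config \<Rightarrow> real) \<Rightarrow> bool list \<Rightarrow> bool"
  where "mobile_cluster c B \<longleftrightarrow>
    length B + 2 \<le> CARD('a) \<and> mobility c B \<and> mass_transport c B"

end

theory Submission
  imports Defs
begin

text \<open>
  The window \<open>W\<^sub>j\<close>, translated to a node \<open>{x, x + 1}\<close>, is a box of \<open>L + 2\<close> sites containing the
  node, minus the node.  Hence, inside a box of \<open>L + 2\<close> sites holding \<open>n + 1\<close> particles, an exchange
  of neighbouring distinct values always sees exactly \<open>n\<close> particles in one of its windows and is
  possible, so that such a box can be rearranged at will.  Moving the box and transporting mass
  across it amounts to two or three such rearrangements of overlapping boxes.
\<close>

section \<open>Boolean lists and adjacent swaps\<close>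

lemma sum_of_bool_nth_eq_count_list: "(\<Sum>k<length xs. of_bool (xs ! k)) = count_list xs True"
  by (induction xs) (simp_all add: sum.lessThan_Suc_shift del: sum.lessThan_Suc)

lemma mset_eq_if_count_list_True_eq:
  assumes "length xs = length ys" and "count_list xs True = count_list ys True"
  shows "mset xs = mset ys"
proof -
  have "count_list zs True + count_list zs False = length zs" for zs
    by (induction zs) auto
  from this[of xs] this[of ys] assms have "count_list xs b = count_list ys b" for b
    by (cases b) auto
  then show ?thesis
    by (simp add: multiset_eq_iff count_mset)
qed

text \<open>As in insertion sort, the head of \<open>ys\<close> is brought to the front of
  \<open>xs\<close> by adjacent swaps, and the tails are treated in the same way. Swaps are assumed
  only for lists with multiset \<open>M\<close>, which is how the length and the particle number of
  a box are kept under control later.\<close>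

lemma adjacent_swap_connected:
  assumes refl: "\<And>us. R us us"
    and trans: "\<And>us vs ws. R us vs \<Longrightarrow> R vs ws \<Longrightarrow> R us ws"
    and swap: "\<And>us a b vs. mset (us @ a # b # vs) = M \<Longrightarrow> R (us @ a # b # vs) (us @ b # a # vs)"
    and "mset xs = M" and "mset ys = M"
  shows "R xs ys"
proof -
  \<comment> \<open>\<open>y\<close> travels leftwards through \<open>ps\<close>: first past the
    tail, with \<open>p\<close> counted into the prefix, then past \<open>p\<close> itself.\<close>
  have front: "R (us @ ps @ y # qs) (us @ y # ps @ qs)" if "mset (us @ ps @ y # qs) = M"
    for us ps qs y
    using that
  proof (induction ps arbitrary: us)
    case Nil
    show ?case by (simp add: refl)
  next
    case (Cons p ps)
    from Cons.prems have "mset ((us @ [p]) @ ps @ y # qs) = M" by simp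
    from Cons.IH[OF this] have "R (us @ (p # ps) @ y # qs) (us @ p # y # ps @ qs)" by simp
    moreover from Cons.prems have "mset (us @ p # y # ps @ qs) = M" by simp
    then have "R (us @ p # y # ps @ qs) (us @ y # p # ps @ qs)" by (rule swap)
    ultimately show ?case
      unfolding append_Cons by (rule trans)
  qed
  \<comment> \<open>The prefix \<open>us\<close> collects the entries already in place; it cannot be
    dropped, since \<open>swap\<close> applies only to whole lists with multiset
    \<open>M\<close>.\<close>
  have "R (us @ xs) (us @ ys)" if "mset xs = mset ys" and "mset (us @ xs) = M" for us
    using that
  proof (induction ys arbitrary: xs us)
    case Nil
    then show ?case by (simp add: refl)
  next
    case (Cons y ys)
    from Cons.prems(1) have "y \<in> set xs"
      by (metis list.set_intros(1) set_mset_mset)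
    then obtain ps qs where xs: "xs = ps @ y # qs"
      by (meson split_list)
    from Cons.prems(2) have "R (us @ xs) (us @ y # ps @ qs)"
      unfolding xs by (rule front)
    moreover from Cons.prems have "mset (ps @ qs) = mset ys" and "mset ((us @ [y]) @ ps @ qs) = M"
      by (simp_all add: xs)
    from Cons.IH[OF this] have "R (us @ y # ps @ qs) (us @ y # ys)" by simp
    ultimately show ?case
      by (rule trans)
  qed
  from this[of "[]"] assms(4,5) show ?thesis by simp
qed

subsection \<open>Windows\<close>

text \<open>Integers with the same residue differ by a multiple of N, and two points of the interval
  differ by less than N.\<close>

lemma of_int_mod_ring_inj_on:
  assumes "b - a < int CARD('a::nontriv)"
  shows "inj_on (of_int :: int \<Rightarrow> 'a mod_ring) {a..b}"
proof (rule inj_onI)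
  fix i j
  assume ij: "i \<in> {a..b}" "j \<in> {a..b}" and "(of_int i :: 'a mod_ring) = of_int j"
  then have "[i = j] (mod int CARD('a))"
    by (metis of_int_eq_iff_cong_CHAR semiring_char_mod_ring)
  then have "int CARD('a) dvd i - j"
    by (metis cong_iff_dvd_diff)
  moreover have "\<bar>i - j\<bar> < int CARD('a)"
    using ij assms by auto
  ultimately have "i - j = 0"
    using dvd_imp_le_int[of "i - j" "int CARD('a)"] by linarith
  then show "i = j" by simp
qed

lemma of_nat_mod_ring_eq_iff:
  assumes "i < CARD('a::nontriv)" and "j < CARD('a)"
  shows "(of_nat i :: 'a mod_ring) = of_nat j \<longleftrightarrow> i = j"
  using assms by (simp add: of_nat_eq_iff_cong_CHAR cong_def)

text \<open>The definition removes the node after reduction modulo N, this form before it. The two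
  agree because L + 2 consecutive integers have distinct residues, so that only the integers 0 and 1
  land on the node.\<close>

lemma window_eq_image:
  assumes "L + 2 \<le> CARD('a::nontriv)" and "j \<le> L"
  shows "(window L j :: 'a mod_ring set) = of_int ` ({- int j .. - int j + int L + 1} - {0, 1})"
proof -
  have "inj_on (of_int :: int \<Rightarrow> 'a mod_ring) {- int j .. - int j + int L + 1}"
    using assms by (intro of_int_mod_ring_inj_on) simp
  moreover have "{0, 1} \<subseteq> {- int j .. - int j + int L + 1}"
    using assms(2) by auto
  ultimately have "of_int ` ({- int j .. - int j + int L + 1} - {0, 1})
      = of_int ` {- int j .. - int j + int L + 1} - (of_int ` {0, 1} :: 'a mod_ring set)"
    by (intro inj_on_image_set_diff) auto
  then show ?thesis
    by (simp add: window_def)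
qed

lemma sum_window:
  fixes g :: "'a::nontriv mod_ring \<Rightarrow> 'b::comm_monoid_add"
  assumes "L + 2 \<le> CARD('a)" and "j \<le> L"
  shows "sum g (window L j) = (\<Sum>i\<in>{- int j .. - int j + int L + 1} - {0, 1}. g (of_int i))"
proof -
  have "inj_on (of_int :: int \<Rightarrow> 'a mod_ring) ({- int j .. - int j + int L + 1} - {0, 1})"
    using assms by (intro inj_on_subset[OF of_int_mod_ring_inj_on]) auto
  then show ?thesis
    using assms by (simp add: window_eq_image sum.reindex)
qed

lemma card_window:
  assumes "L + 2 \<le> CARD('a::nontriv)" and "j \<le> L"
  shows "card (window L j :: 'a mod_ring set) = L"
proof -
  have "card (window L j :: 'a mod_ring set) = card ({- int j .. - int j + int L + 1} - {0, 1})"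
    using sum_window[OF assms, of "\<lambda>_. 1 :: nat"] by simp
  also have "\<dots> = L"
    using assms(2) by (subst card_Diff_subset) auto
  finally show ?thesis .
qed

lemma window_mass_le:
  assumes "L + 2 \<le> CARD('a::nontriv)" and "j \<le> L"
  shows "window_mass L j (\<eta> :: 'a config) \<le> L"
  using sum_mono[of "window L j" "occ \<eta>" "\<lambda>_. 1"]
  by (simp add: window_mass_def card_window[OF assms] occ_def)

lemma window_mass_complement:
  assumes "L + 2 \<le> CARD('a::nontriv)" and "j \<le> L"
  shows "window_mass L j (complement \<eta>) = L - window_mass L j (\<eta> :: 'a config)"
proof -
  have "window_mass L j \<eta> + window_mass L j (complement \<eta>)
      = (\<Sum>x\<in>window L j. occ \<eta> x + occ (complement \<eta>) x)"
    by (simp add: window_mass_def sum.distrib)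
  also have "\<dots> = (\<Sum>x\<in>(window L j :: 'a mod_ring set). 1)"
    by (intro sum.cong) (auto simp: occ_def complement_def)
  also have "\<dots> = L"
    by (simp add: card_window[OF assms])
  finally show ?thesis by simp
qed

text \<open>Translates windows into lists: the index of a window is the number of its sites to the
  left of the node. Seen from the node carrying \<open>a\<close> and \<open>b\<close>, the window
  with index \<open>length us\<close> therefore covers exactly the entries of \<open>us\<close> and
  \<open>vs\<close>.\<close>

lemma window_mass_box:
  fixes \<eta> :: "'a::nontriv config"
  assumes occurs: "occurs_at w (us @ a # b # vs) \<eta>"
    and length: "length (us @ a # b # vs) = L + 2" and "L + 2 \<le> CARD('a)"
  shows "window_mass L (length us) (translate (w + of_nat (length us)) \<eta>) = count_list (us @ vs) True"
proof -
  define j where "j = length us"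
  have "j \<le> L" and vs: "length vs = L - j"
    using length by (simp_all add: j_def)
  let ?g = "\<lambda>i. occ \<eta> (of_int i + (w + of_nat j))"
  \<comment> \<open>The integers from -j to -1 correspond to the entries of \<open>us\<close>, those
    from 2 to L - j + 1 to the entries of \<open>vs\<close>.\<close>
  have split: "{- int j .. - int j + int L + 1} - {0, 1}
      = (\<lambda>k. int k - int j) ` {..<j} \<union> (\<lambda>k. int k + 2) ` {..<L - j}" (is "?S = ?U \<union> ?V")
  proof (intro equalityI subsetI)
    fix i assume "i \<in> ?S"
    then have "i \<in> ?U" if "i < 0"
      using that by (intro image_eqI[of _ _ "nat (i + int j)"]) auto
    moreover from \<open>i \<in> ?S\<close> \<open>j \<le> L\<close> have "i \<in> ?V" if "\<not> i < 0"
      using that by (intro image_eqI[of _ _ "nat (i - 2)"]) auto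
    ultimately show "i \<in> ?U \<union> ?V" by blast
  qed (use \<open>j \<le> L\<close> in auto)
  have nth: "occ \<eta> (w + of_nat k) = of_bool ((us @ a # b # vs) ! k)" if "k < L + 2" for k
    using occurs that length by (simp add: occurs_at_def occ_def)
  have "window_mass L j (translate (w + of_nat j) \<eta>) = sum ?g ?S"
    unfolding window_mass_def sum_window[OF assms(3) \<open>j \<le> L\<close>]
    by (intro sum.cong) (simp_all add: translate_def occ_def)
  also have "\<dots> = sum ?g ?U + sum ?g ?V"
    unfolding split by (intro sum.union_disjoint) auto
  also have "sum ?g ?U = (\<Sum>k<j. occ \<eta> (w + of_nat k))"
    by (subst sum.reindex) (auto simp: inj_on_def algebra_simps)
  also have "\<dots> = (\<Sum>k<length us. of_bool (us ! k))"
    using \<open>j \<le> L\<close> by (intro sum.cong) (auto simp: nth j_def nth_append)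
  also have "sum ?g ?V = (\<Sum>k<L - j. occ \<eta> (w + of_nat (j + 2 + k)))"
    by (subst sum.reindex) (auto simp: inj_on_def algebra_simps)
  also have "\<dots> = (\<Sum>k<length vs. of_bool (vs ! k))"
    using length by (intro sum.cong, simp add: vs, subst nth) (auto simp: nth_append j_def)
  finally show ?thesis
    by (simp add: j_def sum_of_bool_nth_eq_count_list)
qed

subsection \<open>The Bernstein constraints\<close>

lemma bernstein_nonneg: "0 \<le> bernstein n L \<eta>"
  by (simp add: bernstein_def sum_nonneg)

lemma bernstein_le_1: "bernstein n L \<eta> \<le> 1"
proof -
  have "(\<Sum>j = 0..L. of_bool (window_mass L j \<eta> = n)) \<le> (\<Sum>j = 0..L. 1 :: real)"
    by (intro sum_mono) simp
  then show ?thesis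
    by (simp add: bernstein_def)
qed

lemma bernstein_pos:
  assumes "window_mass L j \<eta> = n" and "j \<le> L"
  shows "0 < bernstein n L \<eta>"
proof -
  have "0 < (\<Sum>j = 0..L. of_bool (window_mass L j \<eta> = n) :: real)"
    using assms by (intro sum_pos2[of _ j]) auto
  then show ?thesis
    by (simp add: bernstein_def)
qed

text \<open>Each of the L + 1 windows has exactly one mass between 0 and L, so after exchanging the
  sums every window contributes 1.\<close>

lemma sum_bernstein_eq_1:
  assumes "L + 2 \<le> CARD('a::nontriv)"
  shows "(\<Sum>n = 0..L. bernstein n L (\<eta> :: 'a config)) = 1"
proof -
  have "(\<Sum>n = 0..L. \<Sum>j = 0..L. of_bool (window_mass L j \<eta> = n) :: real)
      = (\<Sum>j = 0..L. \<Sum>n = 0..L. of_bool (window_mass L j \<eta> = n))"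
    by (rule sum.swap)
  also have "\<dots> = (\<Sum>j = 0..L. 1)"
    using window_mass_le[OF assms] by (intro sum.cong) (auto simp: of_bool_def)
  finally show ?thesis
    by (simp add: bernstein_def flip: sum_divide_distrib)
qed

lemma generator_ssep_eq_sum_bernstein:
  fixes f :: "'a::nontriv config \<Rightarrow> real"
  assumes "L + 2 \<le> CARD('a)"
  shows "generator ssep f \<eta> = (\<Sum>n = 0..L. generator (bernstein n L) f \<eta>)"
proof -
  have "(\<Sum>n = 0..L. generator (bernstein n L) f \<eta>)
      = (\<Sum>x\<in>UNIV. \<Sum>n = 0..L. bernstein n L (translate x \<eta>) * grad x (x + 1) f \<eta>)"
    unfolding generator_def by (rule sum.swap)
  also have "\<dots> = generator ssep f \<eta>"
    by (simp add: generator_def ssep_def sum_bernstein_eq_1[OF assms] flip: sum_distrib_right)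
  finally show ?thesis by simp
qed

text \<open>A window has L sites, so complementing the configuration turns mass m into L - m, window
  by window.\<close>

lemma bernstein_complement:
  fixes \<eta> :: "'a::nontriv config"
  assumes "n \<le> L" and "L + 2 \<le> CARD('a)"
  shows "bernstein n L \<eta> = bernstein (L - n) L (complement \<eta>)"
proof -
  have "window_mass L j (complement \<eta>) = L - n \<longleftrightarrow> window_mass L j \<eta> = n" if "j \<le> L" for j
    using window_mass_le[OF assms(2) that, of \<eta>] window_mass_complement[OF assms(2) that, of \<eta>] assms(1)
    by auto
  then show ?thesis
    by (simp add: bernstein_def)
qed

text \<open>For L = n the mass of a window is n only if the window is full, and the indicator of
  this event is the product of the occupation values.\<close>

lemma bernstein_eq_pmm:
  assumes "n + 2 \<le> CARD('a::nontriv)"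
  shows "(bernstein n n :: 'a config \<Rightarrow> real) = pmm n"
proof
  fix \<eta> :: "'a config"
  have window: "of_bool (window_mass n j \<eta> = n)
      = (\<Prod>i\<in>{- int j .. - int j + int n + 1} - {0, 1}. real (occ \<eta> (of_int i)))"
    (is "_ = prod _ ?S") if "j \<le> n" for j
  proof -
    have mass: "window_mass n j \<eta> = (\<Sum>i\<in>?S. occ \<eta> (of_int i))"
      using sum_window[OF assms that] by (simp add: window_mass_def)
    have card: "card ?S = n"
      using that by (subst card_Diff_subset) auto
    show ?thesis
    proof (cases "\<forall>i\<in>?S. \<eta> (of_int i)")
      case True
      then show ?thesis
        using card by (simp add: mass occ_def)
    next
      case False
      then obtain i where "i \<in> ?S" and "\<not> \<eta> (of_int i)" by blast
      then have "window_mass n j \<eta> < (\<Sum>i\<in>?S. 1)"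
        unfolding mass by (intro sum_strict_mono_ex1) (auto simp: occ_def)
      then have "window_mass n j \<eta> \<noteq> n"
        using card by simp
      moreover have "(\<Prod>i\<in>?S. real (occ \<eta> (of_int i))) = 0"
        using \<open>i \<in> ?S\<close> \<open>\<not> \<eta> (of_int i)\<close> by (intro prod_zero bexI[of _ i]) (auto simp: occ_def)
      ultimately show ?thesis by simp
    qed
  qed
  have "(\<Sum>j = 0..n. of_bool (window_mass n j \<eta> = n) :: real)
      = (\<Sum>j = 1..n + 1. \<Prod>i\<in>{- (int n + 1) + int j .. int j} - {0, 1}. real (occ \<eta> (of_int i)))"
    \<comment> \<open>The two sums list the windows in opposite order: the window that starts at -j
      is the one with index n + 1 - j in \<open>pmm\<close>.\<close>
    by (rule sum.reindex_bij_witness[of _ "\<lambda>j. n + 1 - j" "\<lambda>j. n + 1 - j"])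
      (auto simp: window of_nat_diff algebra_simps)
  then show "bernstein n n \<eta> = pmm n \<eta>"
    by (simp add: bernstein_def pmm_def)
qed

lemma bernstein_blocked:
  assumes "1 \<le> L" and "L + 2 \<le> CARD('a::nontriv)"
  shows "\<exists>\<eta> :: 'a config. \<forall>x. bernstein n L (translate x \<eta>) = 0"
proof -
  have const: "window_mass L j (translate x (\<lambda>_. b) :: 'a config) = (if b then L else 0)"
    if "j \<le> L" for j x b
    using card_window[OF assms(2) that] by (simp add: window_mass_def occ_def translate_def)
  \<comment> \<open>The full configuration if n = 0, the empty one otherwise: all windows have mass
    L, which is positive, in the first case and mass 0 in the second, never n.\<close>
  have "bernstein n L (translate x (\<lambda>_. n = 0) :: 'a config) = 0" for x
    using assms(1) by (simp add: bernstein_def const)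
  then show ?thesis by blast
qed

subsection \<open>Transitions\<close>

lemma transition_refl: "transition c P P"
  unfolding transition_def by (auto intro!: exI[of _ "[]"])

lemma jump_seq_append:
  "jump_seq c (xs @ ys) \<eta> \<xi> \<longleftrightarrow> (\<exists>\<zeta>. jump_seq c xs \<eta> \<zeta> \<and> jump_seq c ys \<zeta> \<xi>)"
  by (induction xs arbitrary: \<eta>) auto

text \<open>The jump lists are concatenated. Both are fixed before the configuration, hence so is
  the result, and the two transitions act on the same sites because the patterns have equal
  length.\<close>

lemma transition_trans:
  assumes "transition c P Q" and "transition c Q R"
  shows "transition c P R"
  unfolding transition_def
proof (intro conjI allI)
  show "length P = length R"
    using assms by (simp add: transition_def)
  fix z
  from assms(1) obtain xs where xs: "\<forall>\<eta>. occurs_at z P \<eta> \<longrightarrow> (\<exists>\<zeta>. jump_seq c xs \<eta> \<zeta> \<and>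
      occurs_at z Q \<zeta> \<and> (\<forall>y. y \<notin> pattern_sites z P \<longrightarrow> \<zeta> y = \<eta> y))"
    unfolding transition_def by (elim conjE allE[of _ z] exE)
  from assms(2) obtain ys where ys: "\<forall>\<zeta>. occurs_at z Q \<zeta> \<longrightarrow> (\<exists>\<xi>. jump_seq c ys \<zeta> \<xi> \<and>
      occurs_at z R \<xi> \<and> (\<forall>y. y \<notin> pattern_sites z Q \<longrightarrow> \<xi> y = \<zeta> y))"
    unfolding transition_def by (elim conjE allE[of _ z] exE)
  have sites: "pattern_sites z Q = pattern_sites z P"
    using assms(1) by (simp add: transition_def pattern_sites_def)
  have "\<exists>\<xi>. jump_seq c (xs @ ys) \<eta> \<xi> \<and> occurs_at z R \<xi> \<and>
      (\<forall>y. y \<notin> pattern_sites z P \<longrightarrow> \<xi> y = \<eta> y)" if "occurs_at z P \<eta>" for \<eta>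
  proof -
    from xs that obtain \<zeta> where \<zeta>: "jump_seq c xs \<eta> \<zeta>" "occurs_at z Q \<zeta>"
      "\<forall>y. y \<notin> pattern_sites z P \<longrightarrow> \<zeta> y = \<eta> y" by blast
    moreover from ys \<zeta>(2) obtain \<xi> where "jump_seq c ys \<zeta> \<xi>" "occurs_at z R \<xi>"
      "\<forall>y. y \<notin> pattern_sites z P \<longrightarrow> \<xi> y = \<zeta> y" unfolding sites by blast
    ultimately show ?thesis
      unfolding jump_seq_append by auto
  qed
  then show "\<exists>zs. \<forall>\<eta>. occurs_at z P \<eta> \<longrightarrow> (\<exists>\<xi>. jump_seq c zs \<eta> \<xi> \<and> occurs_at z R \<xi> \<and>
      (\<forall>y. y \<notin> pattern_sites z P \<longrightarrow> \<xi> y = \<eta> y))"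
    by blast
qed

lemma reversible_transition_trans [trans]:
  "reversible_transition c P Q \<Longrightarrow> reversible_transition c Q R \<Longrightarrow> reversible_transition c P R"
  unfolding reversible_transition_def using transition_trans by blast

lemma occurs_at_append:
  "occurs_at z (P @ Q) \<eta> \<longleftrightarrow> occurs_at z P \<eta> \<and> occurs_at (z + of_nat (length P)) Q \<eta>"
proof -
  have "(\<forall>i<length P + length Q. \<eta> (z + of_nat i) = (P @ Q) ! i) \<longleftrightarrow>
      (\<forall>i<length P. \<eta> (z + of_nat i) = P ! i) \<and>
      (\<forall>i<length Q. \<eta> (z + of_nat (length P + i)) = Q ! i)" (is "?l \<longleftrightarrow> ?r")
  proof
    assume l: ?l
    then have "\<eta> (z + of_nat i) = P ! i" if "i < length P" for i
      using that by (auto simp: nth_append dest: spec[of _ i])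
    moreover have "\<eta> (z + of_nat (length P + i)) = Q ! i" if "i < length Q" for i
      using that l[rule_format, of "length P + i"] by simp
    ultimately show ?r by blast
  next
    assume r: ?r
    show ?l
    proof (intro allI impI)
      fix i
      assume "i < length P + length Q"
      with r[THEN conjunct2, rule_format, of "i - length P"] r
      show "\<eta> (z + of_nat i) = (P @ Q) ! i"
        by (cases "i < length P") (auto simp: nth_append simp del: of_nat_add)
    qed
  qed
  then show ?thesis
    by (simp add: occurs_at_def add_ac)
qed

text \<open>A pattern no longer than the torus has distinct sites, so the exchange affects only the
  entries \<open>a\<close> and \<open>b\<close>.\<close>

lemma occurs_at_exchange:
  fixes \<eta> :: "'a::nontriv config"
  assumes "occurs_at z (us @ a # b # vs) \<eta>" and "length (us @ a # b # vs) \<le> CARD('a)"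
  defines "x \<equiv> z + of_nat (length us)"
  shows "occurs_at z (us @ b # a # vs) (exchange x (x + 1) \<eta>)"
  unfolding occurs_at_def
proof (intro allI impI)
  fix i
  assume i: "i < length (us @ b # a # vs)"
  have nth: "\<eta> (z + of_nat k) = (us @ a # b # vs) ! k" if "k < length (us @ a # b # vs)" for k
    using assms(1) that unfolding occurs_at_def by blast
  have a: "\<eta> x = a" and b: "\<eta> (x + 1) = b"
    using nth[of "length us"] nth[of "length us + 1"] by (simp_all add: x_def nth_append add_ac)
  have x: "z + of_nat i = x \<longleftrightarrow> i = length us"
    unfolding x_def add_left_cancel using i assms(2) by (intro of_nat_mod_ring_eq_iff) auto
  have x1: "x + 1 = z + of_nat (length us + 1)"
    by (simp add: x_def)
  have y: "z + of_nat i = x + 1 \<longleftrightarrow> i = length us + 1"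
    unfolding x1 add_left_cancel using i assms(2) by (intro of_nat_mod_ring_eq_iff) auto
  consider "i = length us" | "i = length us + 1" | "i \<noteq> length us" "i \<noteq> length us + 1" by blast
  then show "exchange x (x + 1) \<eta> (z + of_nat i) = (us @ b # a # vs) ! i"
  proof cases
    case 1
    then show ?thesis
      using x by (simp add: exchange_def a b)
  next
    case 2
    then show ?thesis
      using y by (simp add: exchange_def a b nth_append del: of_nat_add)
  next
    case 3
    then show ?thesis
      using x y i nth[of i] by (auto simp: exchange_def nth_append nth_Cons split: nat.splits)
  qed
qed

section \<open>Rearranging a box, and mobile clusters\<close>

text \<open>If \<open>a\<close> and \<open>b\<close> differ, the node carries exactly one of the n +
  1 particles of the box, so the rest of the box is a window of mass n and a single jump is
  possible. If they agree, no jump is made.\<close>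

lemma transition_adjacent_swap:
  assumes length: "length (us @ a # b # vs) = L + 2"
    and count: "count_list (us @ a # b # vs) True = n + 1"
    and fits: "length (As @ (us @ a # b # vs) @ Cs) \<le> CARD('a::nontriv)"
  shows "transition (bernstein n L :: 'a config \<Rightarrow> real)
    (As @ (us @ a # b # vs) @ Cs) (As @ (us @ b # a # vs) @ Cs)"
proof (cases "a = b")
  case True
  then show ?thesis
    by (simp add: transition_refl)
next
  case False
  let ?P = "As @ (us @ a # b # vs) @ Cs"
  \<comment> \<open>The node \<open>x\<close> is determined by \<open>z\<close> and the pattern
    alone, so the jump list can be chosen before the configuration.\<close>
  have "\<exists>\<xi>. jump_seq (bernstein n L) [x] \<eta> \<xi> \<and> occurs_at z (As @ (us @ b # a # vs) @ Cs) \<xi> \<and>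
      (\<forall>y. y \<notin> pattern_sites z ?P \<longrightarrow> \<xi> y = \<eta> y)"
    if occurs: "occurs_at z ?P \<eta>" and x: "x = z + of_nat (length (As @ us))"
    for z x and \<eta> :: "'a config"
  proof -
    have box: "occurs_at (z + of_nat (length As)) (us @ a # b # vs) \<eta>"
      using occurs unfolding occurs_at_append[of _ As] occurs_at_append[of _ "us @ a # b # vs" Cs] by blast
    have "window_mass L (length us) (translate x \<eta>) = count_list (us @ vs) True"
      using window_mass_box[OF box length] fits length by (simp add: x add_ac)
    also have "\<dots> = n"
      using count False by (cases a; cases b) auto
    finally have "0 < bernstein n L (translate x \<eta>)"
      using length by (intro bernstein_pos) auto
    moreover have "\<eta> x = a" and "\<eta> (x + 1) = b"
      using occurs[unfolded occurs_at_def, rule_format, of "length (As @ us)"]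
        occurs[unfolded occurs_at_def, rule_format, of "length (As @ us) + 1"]
      by (simp_all add: x nth_append add_ac)
    ultimately have "possible_jump (bernstein n L) x \<eta>"
      using False by (simp add: possible_jump_def)
    moreover have "occurs_at z (As @ (us @ b # a # vs) @ Cs) (exchange x (x + 1) \<eta>)"
      using occurs_at_exchange[of z "As @ us" a b "vs @ Cs" \<eta>] occurs fits by (simp add: x)
    moreover have "x \<in> pattern_sites z ?P"
      unfolding pattern_sites_def x by (intro imageI) simp
    moreover have "x + 1 \<in> pattern_sites z ?P"
      unfolding pattern_sites_def x
      by (intro image_eqI[of _ _ "length (As @ us) + 1"]) (simp_all add: add_ac)
    ultimately show ?thesis
      by (auto simp: exchange_def)
  qed
  then show ?thesis
    unfolding transition_def by (intro conjI allI) (simp, blast)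
qed

text \<open>\<open>B\<close> and \<open>B'\<close> are permutations of each other, hence connected
  by adjacent swaps. Every intermediate box has the multiset of \<open>B\<close>, so each swap is
  possible in both directions, whatever stands in \<open>As\<close> and \<open>Cs\<close>.\<close>

lemma reversible_transition_rearrange:
  assumes length: "length B = L + 2" "length B' = L + 2"
    and count: "count_list B True = n + 1" "count_list B' True = n + 1"
    and fits: "length (As @ B @ Cs) \<le> CARD('a::nontriv)"
  shows "reversible_transition (bernstein n L :: 'a config \<Rightarrow> real) (As @ B @ Cs) (As @ B' @ Cs)"
proof (rule adjacent_swap_connected[where M = "mset B"
      and R = "\<lambda>X Y. reversible_transition (bernstein n L) (As @ X @ Cs) (As @ Y @ Cs)"])
  show "mset B' = mset B"
    using length count by (intro mset_eq_if_count_list_True_eq) simp_all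
next
  fix us a b vs
  assume mset: "mset (us @ a # b # vs) = mset B"
  have mset': "mset (us @ b # a # vs) = mset B"
    by (simp flip: mset)
  have "length X = L + 2 \<and> count_list X True = n + 1" if "mset X = mset B" for X
    using length(1) count(1) mset_eq_length[OF that] arg_cong[OF that, of "\<lambda>M. count M True"]
    by (simp add: count_mset)
  from this[OF mset] this[OF mset'] fits length(1)
  show "reversible_transition (bernstein n L :: 'a config \<Rightarrow> real)
      (As @ (us @ a # b # vs) @ Cs) (As @ (us @ b # a # vs) @ Cs)"
    unfolding reversible_transition_def by (intro conjI transition_adjacent_swap) simp_all
qed (auto simp: reversible_transition_def transition_refl intro: transition_trans)

text \<open>The box crosses \<open>b\<close> by way of \<open>[b] @ X @ [b]\<close>, whose first and
  last L + 2 entries are both boxes with n + 1 particles.\<close>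

lemma bernstein_mobility:
  assumes "n \<le> L" and length: "length B = L + 2" and count: "count_list B True = n + 1"
    and fits: "L + 3 \<le> CARD('a::nontriv)"
  shows "mobility (bernstein n L :: 'a config \<Rightarrow> real) B"
proof -
  have move: "reversible_transition (bernstein n L :: 'a config \<Rightarrow> real) (B @ [b]) ([b] @ B)"
    if X: "length X = L + 1" "count_list (b # X) True = n + 1" for b X
  proof -
    have "reversible_transition (bernstein n L :: 'a config \<Rightarrow> real) ([] @ B @ [b]) ([] @ (b # X) @ [b])"
      using length count fits X by (intro reversible_transition_rearrange) auto
    \<comment> \<open>The same entries are read with the box shifted one site to the right, leaving
      the leading \<open>b\<close> behind.\<close>
    also have "[] @ (b # X) @ [b] = [b] @ (X @ [b]) @ []" by simp
    also have "reversible_transition (bernstein n L :: 'a config \<Rightarrow> real) \<dots> ([b] @ B @ [])"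
      using length count fits X by (intro reversible_transition_rearrange) auto
    finally show ?thesis by simp
  qed
  have replicate: "count_list (replicate k b) True = (if b then k else 0)" for k b
    by (induction k) auto
  show ?thesis
    unfolding mobility_def
    \<comment> \<open>A suitable \<open>X\<close> exists for both values of \<open>b\<close>: the
      box holds n + 1 particles and L + 1 - n vacancies, and the latter number is positive since n
      is at most L.\<close>
    using assms(1) move[of "replicate n True @ replicate (L + 1 - n) False" True]
      move[of "replicate (n + 1) True @ replicate (L - n) False" False]
    by (simp add: replicate)
qed

text \<open>The box lends the L entries \<open>X\<close> with n particles. Together with the
  adjacent pair, which holds one particle, they form a new box in which the pair can be swapped;
  afterwards the original box is restored.\<close>

lemma bernstein_mass_transport:
  assumes "n \<le> L" and length: "length B = L + 2" and count: "count_list B True = n + 1"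
    and fits: "L + 4 \<le> CARD('a::nontriv)"
  shows "mass_transport (bernstein n L :: 'a config \<Rightarrow> real) B"
proof -
  have replicate: "count_list (replicate k b) True = (if b then k else 0)" for k b
    by (induction k) auto
  define X where "X = replicate n True @ replicate (L - n) False"
  have X: "length X = L" "count_list X True = n"
    using assms(1) by (simp_all add: X_def replicate)
  note rearrange = reversible_transition_rearrange[where 'a = 'a and L = L and n = n]
  have "reversible_transition (bernstein n L :: 'a config \<Rightarrow> real)
      ([] @ B @ [False, True]) ([] @ ([False, True] @ X) @ [False, True])"
    using length count fits X by (intro rearrange) auto
  also have "[] @ ([False, True] @ X) @ [False, True] = [False, True] @ (X @ [False, True]) @ []"
    by simp
  also have "reversible_transition (bernstein n L :: 'a config \<Rightarrow> real)
      \<dots> ([False, True] @ (X @ [True, False]) @ [])"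
    using length count fits X by (intro rearrange) auto
  also have "[False, True] @ (X @ [True, False]) @ [] = [] @ ([False, True] @ X) @ [True, False]"
    by simp
  also have "reversible_transition (bernstein n L :: 'a config \<Rightarrow> real)
      \<dots> ([] @ B @ [True, False])"
    using length count fits X by (intro rearrange) auto
  finally have right: "reversible_transition (bernstein n L :: 'a config \<Rightarrow> real)
      (B @ [False, True]) (B @ [True, False])" by simp
  \<comment> \<open>The mirror image: the spare pair \<open>[False, True]\<close> is now parked at
    the right end, so that \<open>X\<close> touches the pair on the left.\<close>
  have "reversible_transition (bernstein n L :: 'a config \<Rightarrow> real)
      ([False, True] @ B @ []) ([False, True] @ (X @ [False, True]) @ [])"
    using length count fits X by (intro rearrange) auto
  also have "[False, True] @ (X @ [False, True]) @ [] = [] @ ([False, True] @ X) @ [False, True]"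
    by simp
  also have "reversible_transition (bernstein n L :: 'a config \<Rightarrow> real)
      \<dots> ([] @ ([True, False] @ X) @ [False, True])"
    using length count fits X by (intro rearrange) auto
  also have "[] @ ([True, False] @ X) @ [False, True] = [True, False] @ (X @ [False, True]) @ []"
    by simp
  also have "reversible_transition (bernstein n L :: 'a config \<Rightarrow> real)
      \<dots> ([True, False] @ B @ [])"
    using length count fits X by (intro rearrange) auto
  finally have left: "reversible_transition (bernstein n L :: 'a config \<Rightarrow> real)
      ([False, True] @ B) ([True, False] @ B)" by simp
  show ?thesis
    using left right by (simp add: mass_transport_def)
qed

theorem proposition2p8:
  fixes n L :: nat
  assumes "n \<le> L" and "1 \<le> L" and "L + 2 \<le> CARD('a::nontriv)"
  shows
    "(\<forall>L::nat. 0 < L \<and> real L < real CARD('a) / 2 \<longrightarrow>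
        (\<forall>(f :: 'a config \<Rightarrow> real) \<eta>.
          generator ssep f \<eta> = (\<Sum>n = 0..L. generator (bernstein n L) f \<eta>))) \<and>
     (\<forall>\<eta> :: 'a config. bernstein n L \<eta> = bernstein (L - n) L (complement \<eta>)) \<and>
     (\<forall>n::nat. 1 \<le> n \<and> n + 2 \<le> CARD('a) \<longrightarrow>
        (bernstein n n :: 'a config \<Rightarrow> real) = pmm n) \<and>
     (\<forall>\<eta> :: 'a config. bernstein n L \<eta> \<in> {0..1}) \<and>
     (\<exists>\<eta> :: 'a config. \<forall>x. bernstein n L (translate x \<eta>) = 0) \<and>
     (L + 4 \<le> CARD('a) \<longrightarrow>
        (\<forall>B :: bool list. length B = L + 2 \<and> count_list B True = n + 1 \<longrightarrow>
          mobile_cluster (bernstein n L :: 'a config \<Rightarrow> real) B))"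
proof (intro conjI allI impI, goal_cases)
  case (1 L f \<eta>)
  \<comment> \<open>Since L is at least 1 and 2 L < N, integrality gives N at least 2 L + 1, hence
    at least L + 2.\<close>
  then have "L + 2 \<le> CARD('a)" by linarith
  then show ?case
    by (rule generator_ssep_eq_sum_bernstein)
next
  case (2 \<eta>)
  show ?case
    using assms by (intro bernstein_complement)
next
  case (3 n)
  then show ?case
    by (intro bernstein_eq_pmm) simp
next
  case (4 \<eta>)
  show ?case
    by (simp add: bernstein_nonneg bernstein_le_1)
next
  case 5
  show ?case
    using assms by (intro bernstein_blocked)
next
  case (6 B)
  then show ?case
    using assms(1) by (simp add: mobile_cluster_def bernstein_mobility bernstein_mass_transport)
qed

end
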